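(* Let $P_{XY}$ be a probability measure defined on $\mathcal{X}\times\mathcal{Y}$ with $|\mathcal{X}|=M<\infty$, such that $P_{X|Y}(x|y)>0$ for all $(x,y)\in\mathcal{X}\times\mathcal{Y}$, and let $\mathcal{L}\colon\mathcal{Y}\to\binom{\mathcal{X}}{L}$ with $1\le L\le M$. Then, for all $\alpha\in(-\infty,0)$, the probability $P_{\mathcal{L}}=\mathbb{P}[X\notin\mathcal{L}(Y)]$ that the decoding list does not include the correct decision satisfies $$P_{\mathcal{L}}\ge\exp\left(\frac{1-\alpha}{\alpha}\Bigl[H_\alpha(X|Y)-\log(M-L)\Bigr]\right).$$
   Context: Logarithms have an arbitrary fixed base larger than 1 and $\exp$ is the inverse of $\log$, with $\log0=-\infty$ and $\exp(-\infty)=0$. $(X,Y)\sim P_{XY}$, with $\mathcal{Y}$ an arbitrary observation space. $\binom{\mathcal{X}}{L}$ denotes the set of all subsets of $\mathcal{X}$ of cardinality $L$. For $\alpha\in(-\infty,0)$ (and $P_{X|Y}>0$ on the finite set $\mathcal{X}$) the Arimoto-R\'enyi conditional entropy of order $\alpha$ is $$H_\alpha(X|Y)=\frac{\alpha}{1-\alpha}\log\mathbb{E}\left[\Bigl(\sum_{x\in\mathcal{X}}P_{X|Y}^\alpha(x|Y)\Bigr)^{1/\alpha}\right],$$ the expectation being over $Y\sim P_Y$. *)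

theory Defs
  imports "HOL-Probability.Probability"
begin

(* Logarithm and exponential to base b with log 0 = -\<infinity> and exp (-\<infinity>) = 0;
   elog is only meant for arguments x \<ge> 0. *)

definition elog :: "real \<Rightarrow> real \<Rightarrow> ereal" where
  "elog b x = (if x = 0 then -\<infinity> else ereal (log b x))"

definition eexp :: "real \<Rightarrow> ereal \<Rightarrow> ereal" where
  "eexp b x =
     (if x = \<infinity> then \<infinity> else if x = -\<infinity> then 0 else ereal (b powr real_of_ereal x))"

abbreviation snd_marginal :: "('x \<times> 'y) measure \<Rightarrow> 'y measure \<Rightarrow> 'y measure" where
  "snd_marginal P N \<equiv> distr P N snd"

(* p x y is a (regular) version of P_{X|Y}(x|y): a probability mass function on X for every y,
   measurable in y, which disintegrates P along its marginal on N. *)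

definition is_cond_mass_fun ::
  "'x set \<Rightarrow> 'y measure \<Rightarrow> ('x \<times> 'y) measure \<Rightarrow> ('x \<Rightarrow> 'y \<Rightarrow> real) \<Rightarrow> bool" where
  "is_cond_mass_fun X N P p \<longleftrightarrow>
     (\<forall>x\<in>X. p x \<in> borel_measurable N) \<and>
     (\<forall>y\<in>space N. (\<forall>x\<in>X. 0 \<le> p x y) \<and> (\<Sum>x\<in>X. p x y) = 1) \<and>
     (\<forall>x\<in>X. \<forall>B\<in>sets N.
        measure P ({x} \<times> B) = set_lebesgue_integral (snd_marginal P N) B (p x))"

(* Orders \<alpha> < 0 and p > 0 only: for p x y = 0 the library's 0 powr \<alpha> = 0 would be the wrong
   convention. *)

definition arimoto_renyi_cond_entropy ::
  "real \<Rightarrow> real \<Rightarrow> 'x set \<Rightarrow> 'y measure \<Rightarrow> ('x \<times> 'y) measure \<Rightarrow> ('x \<Rightarrow> 'y \<Rightarrow> real) \<Rightarrow> ereal" where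
  "arimoto_renyi_cond_entropy b \<alpha> X N P p =
     ereal (\<alpha> / (1 - \<alpha>)) *
     elog b (integral\<^sup>L (snd_marginal P N) (\<lambda>y. (\<Sum>x\<in>X. p x y powr \<alpha>) powr (1 / \<alpha>)))"

end

theory Submission
  imports Defs
begin

text \<open>Given \<open>Y = y\<close>, the error probability is the sum of the \<open>M - L\<close> masses outside the list. Jensen's
  inequality for the convex function \<open>t \<mapsto> t\<^sup>\<alpha>\<close> bounds it from below by \<open>(M - L) powr (1 - 1 / \<alpha>)\<close> times
  their \<open>\<alpha>\<close>-quasinorm, which only decreases when the sum is extended to all of \<open>X\<close>, since \<open>\<alpha> < 0\<close>.
  Averaging over \<open>Y\<close> yields the theorem.\<close>

lemma convex_on_powr_neg:
  fixes a :: real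
  assumes "a < 0"
  shows "convex_on {0<..} (\<lambda>x. x powr a)"
proof (rule f''_ge0_imp_convex)
  show "((\<lambda>x. x powr a) has_real_derivative a * x powr (a - 1)) (at x)" if "x \<in> {0<..}" for x
    using that by (auto intro!: derivative_eq_intros)
  show "((\<lambda>x. a * x powr (a - 1)) has_real_derivative a * ((a - 1) * x powr (a - 1 - 1))) (at x)"
    if "x \<in> {0<..}" for x
    using that by (auto intro!: derivative_eq_intros)
  show "a * ((a - 1) * x powr (a - 1 - 1)) \<ge> 0" for x
    using assms by (intro mult_nonpos_nonpos) (auto intro: mult_nonpos_nonneg)
qed simp

text \<open>Jensen with equal weights \<open>1 / K\<close>, where \<open>K = card S\<close>, bounds
  the \<open>a\<close>-th power of the mean of \<open>f\<close> by the mean of the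
  \<open>a\<close>-th powers.\<close>

lemma sum_ge_card_powr_mult_neg_quasinorm:
  fixes f :: "'a \<Rightarrow> real" and a :: real
  assumes "finite S" "S \<noteq> {}" "\<And>x. x \<in> S \<Longrightarrow> f x > 0" "a < 0"
  shows "(\<Sum>x\<in>S. f x) \<ge> real (card S) powr (1 - 1 / a) * (\<Sum>x\<in>S. f x powr a) powr (1 / a)"
proof -
  define K where "K = real (card S)"
  have K: "K > 0" using assms by (simp add: K_def card_gt_0_iff)
  have A: "(\<Sum>x\<in>S. f x) > 0" and B: "(\<Sum>x\<in>S. f x powr a) > 0"
    using assms by (auto intro!: sum_pos simp: less_imp_neq[THEN not_sym])
  have "(\<Sum>x\<in>S. (1 / K) *\<^sub>R f x) powr a \<le> (\<Sum>x\<in>S. (1 / K) * f x powr a)"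
    using assms K
    by (intro convex_on_sum[OF _ _ convex_on_powr_neg]) (auto simp: K_def)
  then have "((\<Sum>x\<in>S. f x) / K) powr a \<le> (\<Sum>x\<in>S. f x powr a) / K"
    by (simp add: sum_divide_distrib)
  \<comment> \<open>The exponent \<open>1 / a\<close> is negative, so applying it reverses the
    inequality, turning Jensen's upper bound into a lower bound on the mean. Clearing
    \<open>K\<close> then leaves the factor \<open>K * K powr (- 1 / a)\<close>.\<close>
  then have "((\<Sum>x\<in>S. f x powr a) / K) powr (1 / a) \<le> (((\<Sum>x\<in>S. f x) / K) powr a) powr (1 / a)"
    using assms A K by (intro powr_mono2') (auto simp: divide_simps)
  also have "\<dots> = (\<Sum>x\<in>S. f x) / K"
    using assms A K by (simp add: powr_powr)
  finally show ?thesis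
    using A B K by (simp add: powr_divide powr_diff field_simps flip: K_def)
qed

lemma sum_compl_ge_card_powr_mult_neg_quasinorm:
  fixes f :: "'a \<Rightarrow> real" and a :: real
  assumes "finite X" "S \<subseteq> X" "S \<noteq> {}" "\<And>x. x \<in> X \<Longrightarrow> f x > 0" "a < 0"
  shows "(\<Sum>x\<in>S. f x) \<ge> real (card S) powr (1 - 1 / a) * (\<Sum>x\<in>X. f x powr a) powr (1 / a)"
proof -
  have S: "finite S" using assms finite_subset by blast
  have "(\<Sum>x\<in>S. f x powr a) > 0"
    using assms S by (intro sum_pos) (force simp: less_imp_neq[THEN not_sym])+
  moreover have "(\<Sum>x\<in>S. f x powr a) \<le> (\<Sum>x\<in>X. f x powr a)"
    using assms by (intro sum_mono2) auto
  ultimately have "(\<Sum>x\<in>X. f x powr a) powr (1 / a) \<le> (\<Sum>x\<in>S. f x powr a) powr (1 / a)"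
    using assms by (intro powr_mono2') (auto simp: divide_simps)
  then have "real (card S) powr (1 - 1 / a) * (\<Sum>x\<in>X. f x powr a) powr (1 / a)
      \<le> real (card S) powr (1 - 1 / a) * (\<Sum>x\<in>S. f x powr a) powr (1 / a)"
    by (intro mult_left_mono) auto
  also have "\<dots> \<le> (\<Sum>x\<in>S. f x)"
    using assms S by (intro sum_ge_card_powr_mult_neg_quasinorm) auto
  finally show ?thesis .
qed

text \<open>The integrand is the conditional error probability given \<open>Y = y\<close>. Since
  \<open>X\<close> is finite, the error event splits into finitely many rectangles, to which the
  disintegration property applies. The form \<open>has_bochner_integral\<close> delivers
  integrability together with the value.\<close>

lemma has_bochner_integral_prob_not_in_list:
  fixes \<L> :: "'y \<Rightarrow> 'x set"
  assumes "finite X" and "prob_space P" and P: "sets P = sets (count_space X \<Otimes>\<^sub>M N)"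
    and p: "is_cond_mass_fun X N P p"
    and L: "\<L> \<in> N \<rightarrow>\<^sub>M count_space A"
  shows "has_bochner_integral (snd_marginal P N) (\<lambda>y. \<Sum>x\<in>X - \<L> y. p x y)
    (\<P>(z in P. fst z \<notin> \<L> (snd z)))"
proof -
  interpret P: prob_space P by fact
  define Q where "Q = snd_marginal P N"
  have snd: "snd \<in> P \<rightarrow>\<^sub>M N"
    using measurable_snd measurable_cong_sets[OF P refl] by blast
  interpret Q: prob_space Q
    unfolding Q_def by (rule P.prob_space_distr[OF snd])
  have Q: "sets Q = sets N" "space Q = space N"
    by (simp_all add: Q_def)
  have space: "space P = X \<times> space N"
    using sets_eq_imp_space_eq[OF P] by (simp add: space_pair_measure)
  define B where "B x = {y \<in> space N. x \<notin> \<L> y}" for x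
  \<comment> \<open>\<open>B x\<close> is the preimage under \<open>\<L>\<close> of the lists in
    \<open>A\<close> that miss \<open>x\<close>; every subset of \<open>A\<close> is measurable in
    \<open>count_space A\<close>.\<close>
  have B: "B x \<in> sets N" for x
    using measurable_sets[OF L, of "{S \<in> A. x \<notin> S}"] measurable_space[OF L]
    by (auto simp: B_def vimage_def Int_def conj_commute cong: conj_cong)
  have pm: "p x \<in> borel_measurable Q" if "x \<in> X" for x
    using p that by (auto simp: is_cond_mass_fun_def measurable_cong_sets[OF Q(1) refl])
  have p01: "0 \<le> p x y" "p x y \<le> 1" if "x \<in> X" "y \<in> space N" for x y
  proof -
    show "0 \<le> p x y" using p that by (auto simp: is_cond_mass_fun_def)
    have "p x y \<le> (\<Sum>x\<in>X. p x y)"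
      using p that \<open>finite X\<close> by (intro member_le_sum) (auto simp: is_cond_mass_fun_def)
    then show "p x y \<le> 1" using p that by (auto simp: is_cond_mass_fun_def)
  qed
  have int: "integrable Q (\<lambda>y. indicator (B x) y *\<^sub>R p x y)" if "x \<in> X" for x
    using that pm B p01 Q
    by (intro Q.integrable_const_bound[where B = 1] AE_I2) (auto simp: indicator_def)
  have "{z \<in> space P. fst z \<notin> \<L> (snd z)} = (\<Union>x\<in>X. {x} \<times> B x)"
    by (auto simp: space B_def)
  then have "\<P>(z in P. fst z \<notin> \<L> (snd z)) = (\<Sum>x\<in>X. measure P ({x} \<times> B x))"
    using \<open>finite X\<close> B P
    by (auto intro!: P.finite_measure_finite_Union simp: disjoint_family_on_def)
  also have "\<dots> = (\<Sum>x\<in>X. \<integral>y. indicator (B x) y *\<^sub>R p x y \<partial>Q)"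
    using p B by (intro sum.cong) (auto simp: is_cond_mass_fun_def set_lebesgue_integral_def Q_def)
  finally have "has_bochner_integral Q (\<lambda>y. \<Sum>x\<in>X. indicator (B x) y *\<^sub>R p x y)
      (\<P>(z in P. fst z \<notin> \<L> (snd z)))"
    using int by (auto intro!: has_bochner_integral_sum has_bochner_integral_integrable)
  \<comment> \<open>For fixed \<open>y\<close>, the indicators remove exactly the summands with
    \<open>x\<close> in \<open>\<L> y\<close>.\<close>
  moreover have "has_bochner_integral Q (\<lambda>y. \<Sum>x\<in>X. indicator (B x) y *\<^sub>R p x y) c
      \<longleftrightarrow> has_bochner_integral Q (\<lambda>y. \<Sum>x\<in>X - \<L> y. p x y) c" for c
    using \<open>finite X\<close> Q
    by (intro has_bochner_integral_cong refl sum.mono_neutral_cong_right) (auto simp: B_def)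
  ultimately show ?thesis
    unfolding Q_def by blast
qed

theorem theorem9:
  fixes X :: "'x set" and N :: "'y measure" and P :: "('x \<times> 'y) measure"
    and p :: "'x \<Rightarrow> 'y \<Rightarrow> real" and \<L> :: "'y \<Rightarrow> 'x set"
    and M L :: nat and b \<alpha> :: real
  assumes "b > 1"
    and "finite X" and "card X = M"
    and "prob_space P" and "sets P = sets (count_space X \<Otimes>\<^sub>M N)"
    and "is_cond_mass_fun X N P p"
    and "\<And>x y. x \<in> X \<Longrightarrow> y \<in> space N \<Longrightarrow> p x y > 0"
    and "1 \<le> L" and "L \<le> M"
    and "\<L> \<in> N \<rightarrow>\<^sub>M count_space {S. S \<subseteq> X \<and> card S = L}"
    and "\<alpha> < 0"
  shows "ereal (\<P>(z in P. fst z \<notin> \<L> (snd z))) \<ge>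
    eexp b (ereal ((1 - \<alpha>) / \<alpha>) *
      (arimoto_renyi_cond_entropy b \<alpha> X N P p - elog b (real M - real L)))"
proof -
  interpret P: prob_space P by fact
  define Q where "Q = snd_marginal P N"
  have snd: "snd \<in> P \<rightarrow>\<^sub>M N"
    using measurable_snd measurable_cong_sets[OF assms(5) refl] by blast
  interpret Q: prob_space Q
    unfolding Q_def by (rule P.prob_space_distr[OF snd])
  have Q: "sets Q = sets N" "space Q = space N"
    by (simp_all add: Q_def)
  have X: "X \<noteq> {}" using assms by auto
  have [measurable]: "p x \<in> borel_measurable Q" if "x \<in> X" for x
    using assms(6) that by (auto simp: is_cond_mass_fun_def measurable_cong_sets[OF Q(1) refl])
  have p: "p x y > 0" "(\<Sum>x\<in>X. p x y) = 1" if "x \<in> X" "y \<in> space N" for x y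
    using assms(6,7) that by (auto simp: is_cond_mass_fun_def)
  \<comment> \<open>The mean of \<open>g\<close> is the expectation inside the entropy, and that of
    \<open>f\<close> is the error probability. What remains is a pointwise comparison of
    \<open>f\<close> with a multiple of \<open>g\<close>.\<close>
  define g where "g y = (\<Sum>x\<in>X. p x y powr \<alpha>) powr (1 / \<alpha>)" for y
  define f where "f y = (\<Sum>x\<in>X - \<L> y. p x y)" for y
  have g_pos: "g y > 0" if "y \<in> space N" for y
  proof -
    have "(\<Sum>x\<in>X. p x y powr \<alpha>) > 0"
      using that X p(1) assms(2) by (intro sum_pos) (force simp: less_imp_neq[THEN not_sym])+
    then show ?thesis by (simp add: g_def)
  qed
  \<comment> \<open>The inequality for the whole of \<open>X\<close>, where the masses sum to 1,
    with a factor at least 1 because \<open>1 - 1 / \<alpha>\<close> is positive. This bound makes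
    \<open>g\<close> integrable.\<close>
  have g_le: "g y \<le> 1" if "y \<in> space N" for y
  proof -
    have "real (card X) powr (1 - 1 / \<alpha>) * g y \<le> (\<Sum>x\<in>X. p x y)"
      unfolding g_def using assms(2,11) X p(1) that
      by (intro sum_ge_card_powr_mult_neg_quasinorm) auto
    also have "\<dots> = 1" using X p(2) that by auto
    finally have "real (card X) powr (1 - 1 / \<alpha>) * g y \<le> 1" .
    moreover have "1 \<le> real (card X) powr (1 - 1 / \<alpha>)"
      using assms by (intro ge_one_powr_ge_zero) (auto simp: divide_simps)
    then have "1 * g y \<le> real (card X) powr (1 - 1 / \<alpha>) * g y"
      using g_pos[OF that] by (intro mult_right_mono) auto
    ultimately show ?thesis by simp
  qed
  have int_g: "integrable Q g"
  proof (rule Q.integrable_const_bound[where B = 1])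
    show "AE y in Q. norm (g y) \<le> 1"
      using g_le g_pos Q by (intro AE_I2) (auto simp: less_imp_le)
    show "g \<in> borel_measurable Q" unfolding g_def by measurable
  qed
  define E where "E = (\<integral>y. g y \<partial>Q)"
  \<comment> \<open>Positivity keeps \<open>elog b E\<close> away from its value at 0, so the
    entropy is a finite real number.\<close>
  have E: "E > 0"
  proof -
    have "(\<integral>y. 0 \<partial>Q) < (\<integral>y. g y \<partial>Q)"
      using int_g g_pos[folded Q(2)]
      by (intro Q.integral_less_AE_space) (auto simp: Q.emeasure_space_1)
    then show ?thesis by (simp add: E_def)
  qed
  have H: "arimoto_renyi_cond_entropy b \<alpha> X N P p = ereal (\<alpha> / (1 - \<alpha>) * log b E)"
    using E by (simp add: arimoto_renyi_cond_entropy_def elog_def E_def g_def Q_def)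
  have int_f: "integrable Q f" and prob: "(\<integral>y. f y \<partial>Q) = \<P>(z in P. fst z \<notin> \<L> (snd z))"
    using has_bochner_integral_prob_not_in_list[OF assms(2,4,5,6,10)]
    by (simp_all add: f_def[abs_def] Q_def has_bochner_integral_iff)
  show ?thesis
  proof (cases "L = M")
    case True
    \<comment> \<open>Here \<open>elog b 0\<close> is minus infinity, so the difference is plus
      infinity. The negative factor makes the exponent minus infinity, and the claimed bound is
      0.\<close>
    have "(1 - \<alpha>) / \<alpha> < 0" using assms(11) by (simp add: divide_simps)
    then show ?thesis using True H assms(11) by (simp add: elog_def eexp_def)
  next
    case False
    define K where "K = real M - real L"
    have K: "K > 0" using False assms(9) by (simp add: K_def)
    have le: "K powr (1 - 1 / \<alpha>) * g y \<le> f y" if "y \<in> space N" for y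
    proof -
      have y: "\<L> y \<subseteq> X" "card (\<L> y) = L"
        using measurable_space[OF assms(10) that] by auto
      then have "card (X - \<L> y) = M - L"
        using assms(2,3) by (metis card_Diff_subset finite_subset)
      then have card: "real (card (X - \<L> y)) = K"
        using assms(9) by (simp add: K_def)
      then have "X - \<L> y \<noteq> {}" using K by (metis card.empty of_nat_0 less_irrefl)
      then show ?thesis
        unfolding f_def g_def card[symmetric] using assms(2,11) p(1) that
        by (intro sum_compl_ge_card_powr_mult_neg_quasinorm) auto
    qed
    have "eexp b (ereal ((1 - \<alpha>) / \<alpha>) *
        (arimoto_renyi_cond_entropy b \<alpha> X N P p - elog b (real M - real L)))
      = b powr ((1 - \<alpha>) / \<alpha> * (\<alpha> / (1 - \<alpha>) * log b E - log b K))"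
      using H K by (simp add: elog_def eexp_def K_def)
    \<comment> \<open>The outer factor cancels the coefficient in the entropy, and its negative is
      \<open>1 - 1 / \<alpha>\<close>, the exponent that Jensen's inequality gives to
      \<open>K\<close>.\<close>
    also have "(1 - \<alpha>) / \<alpha> * (\<alpha> / (1 - \<alpha>) * log b E - log b K)
        = log b E + (1 - 1 / \<alpha>) * log b K"
      using assms(11) by (simp add: divide_simps) (simp add: algebra_simps)
    also have "b powr \<dots> = K powr (1 - 1 / \<alpha>) * E"
      using assms(1) K E by (simp add: powr_add log_powr[symmetric] del: log_powr)
    also have "\<dots> = (\<integral>y. K powr (1 - 1 / \<alpha>) * g y \<partial>Q)"
      by (simp add: E_def)
    also have "\<dots> \<le> (\<integral>y. f y \<partial>Q)"
      using int_f int_g le Q by (intro integral_mono) auto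
    finally show ?thesis by (simp add: prob)
  qed
qed

end
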